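(* Let $\boldsymbol{Z}=\{z_{i,j}\in\mathbb{F}^2: i,j\in\mathbb{N}\}$ be a node set, let $m,n\in\mathbb{N}$, let $(i_0,j_0)\preceq(m,n)$ with $(i_0,j_0)\neq(m,n)$, let $z^*_{i_0,j_0}\in\mathbb{F}^2$, and let $\boldsymbol{Z}^*$ be the node set obtained from $\boldsymbol{Z}$ by replacing $z_{i_0,j_0}$ with $z^*_{i_0,j_0}$ (all other nodes unchanged). Then $$\tilde g_{m,n}((x,y);\boldsymbol{Z}^* )=\tilde g_{m,n}((x,y);\boldsymbol{Z})-\binom{m}{i_0}\binom{n}{j_0}\,\tilde g_{m-i_0,n-j_0}(z^*_{i_0,j_0};\boldsymbol{L}^{i_0}\boldsymbol{D}^{j_0}\boldsymbol{Z})\,\tilde g_{i_0,j_0}((x,y);\boldsymbol{Z}),$$ where $\boldsymbol{L}^{i_0}\boldsymbol{D}^{j_0}\boldsymbol{Z}=\{w_{a,b}=z_{a+i_0,b+j_0}: a,b\in\mathbb{N}\}$ and $\tilde g_{m-i_0,n-j_0}(z^*_{i_0,j_0};\cdot)$ denotes evaluation of the polynomial at $(x,y)=z^*_{i_0,j_0}$.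
   Context: $\mathbb{F}$ is a field of characteristic zero. For $p\in\mathbb{F}[x,y]$, $\Delta_x p(x,y)=p(x,y)-p(x-1,y)$ and $\Delta_y p(x,y)=p(x,y)-p(x,y-1)$. For $z\in\mathbb{F}^2$, $\varepsilon(z)$ denotes evaluation at $(x,y)=z$. Write $(i,j)\preceq(m,n)$ if $i\le m$ and $j\le n$. $\Pi^2_{m,n}$ is the space of polynomials of degree at most $m$ in $x$ and at most $n$ in $y$. For a node set $\boldsymbol{W}=\{w_{i,j}\}$ and $m,n\in\mathbb{N}$, $\tilde g_{m,n}((x,y);\boldsymbol{W})$ is the unique polynomial in $\Pi^2_{m,n}$ with $\varepsilon(w_{i,j})\Delta_x^i\Delta_y^j\tilde g_{m,n}((x,y);\boldsymbol{W})=m!\,n!\,\delta_{m,i}\delta_{n,j}$ for all $(i,j)\preceq(m,n)$. *)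

theory Defs
  imports Complex_Main "HOL-Computational_Algebra.Polynomial"
begin

(* F[x,y] is rendered as (F[x])[y]: the inner variable is x, the outer variable is y,
   so coeff (coeff p k) l is the coefficient of x^l y^k. *)
type_synonym 'a bpoly = "'a poly poly"

definition eval2 :: "'a::comm_ring_1 \<times> 'a \<Rightarrow> 'a bpoly \<Rightarrow> 'a" where
  "eval2 z p = poly (poly p [:snd z:]) (fst z)"

(* p(x,y) - p(x-1,y): the substitution acts on every coefficient in F[x]. *)
definition Delta_x :: "'a::comm_ring_1 bpoly \<Rightarrow> 'a bpoly" where
  "Delta_x p = p - map_poly (\<lambda>q. pcompose q [:-1, 1:]) p"

definition Delta_y :: "'a::comm_ring_1 bpoly \<Rightarrow> 'a bpoly" where
  "Delta_y p = p - pcompose p [:-1, 1:]"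

definition Pi2 :: "nat \<Rightarrow> nat \<Rightarrow> 'a::comm_ring_1 bpoly set" where
  "Pi2 m n = {p. (\<forall>k. degree (coeff p k) \<le> m) \<and> degree p \<le> n}"

(* A node set is an indexed family; the nodes need not be distinct. *)
type_synonym 'a nodes = "nat \<times> nat \<Rightarrow> 'a \<times> 'a"

(* In characteristic 0 exactly one polynomial satisfies this description. *)
definition gtilde :: "nat \<Rightarrow> nat \<Rightarrow> 'a::field_char_0 nodes \<Rightarrow> 'a bpoly" where
  "gtilde m n W = (THE g. g \<in> Pi2 m n \<and>
     (\<forall>i\<le>m. \<forall>j\<le>n. eval2 (W (i, j)) ((Delta_x ^^ i) ((Delta_y ^^ j) g)) =
        fact m * fact n * (if i = m then 1 else 0) * (if j = n then 1 else 0)))"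

(* L^i D^j W, where L shifts the first index by one and D the second. *)
definition shift_nodes :: "nat \<Rightarrow> nat \<Rightarrow> 'a nodes \<Rightarrow> 'a nodes" where
  "shift_nodes i j W = (\<lambda>(a, b). W (a + i, b + j))"

end

(* Since Delta_x and Delta_y lower the x- and y-degree and commute, the interpolation problem is
   triangular in the order of the indices, so it has a unique solution for every node set.
   By uniqueness, Delta_x^i0 Delta_y^j0 maps gtilde m n Z to a multiple of the solution of type
   (m - i0, n - j0) for the shifted nodes. On the other hand gtilde i0 j0 Z is annihilated by all
   the functionals except the one with index (i0, j0), which has a constant value that does not
   depend on the node; hence subtracting the right multiple of it repairs the one condition that
   changes with the node. *)
theory Submission
  imports Defs
begin

section \<open>The backward difference of univariate polynomials\<close>

text \<open>Kept polymorphic in the coefficient ring: over the field it acts on the coefficients of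
  \<open>Delta_x\<close>, and over polynomials in \<open>x\<close> it is \<open>Delta_y\<close>
  itself.\<close>

definition bdiff :: "'a::comm_ring_1 poly \<Rightarrow> 'a poly" where
  "bdiff p = p - pcompose p [:-1, 1:]"

lemma bdiff_0 [simp]: "bdiff 0 = 0"
  by (simp add: bdiff_def)

text \<open>Product rule for multiplication by the variable, with the shifted polynomial written as
  \<open>p - bdiff p\<close> so that inductions over \<open>pCons\<close> meet only
  \<open>bdiff\<close>.\<close>

lemma bdiff_pCons: "bdiff (pCons a p) = pCons 0 (bdiff p) + p - bdiff p"
proof -
  have "pCons a p = [:a:] + pCons 0 p"
    by simp
  then show ?thesis
    by (simp add: bdiff_def pcompose_pCons)
qed

lemma bdiff_diff: "bdiff (p - q) = bdiff p - bdiff q"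
  by (simp add: bdiff_def pcompose_diff)

lemma bdiff_add: "bdiff (p + q) = bdiff p + bdiff q"
  by (simp add: bdiff_def pcompose_add)

lemma bdiff_smult: "bdiff (smult c p) = smult c (bdiff p)"
  by (simp add: bdiff_def pcompose_smult smult_diff_right)

lemma bdiff_eq_0: "degree p = 0 \<Longrightarrow> bdiff p = 0"
  by (auto simp: bdiff_def elim!: degree_eq_zeroE)

text \<open>Both claims go through one induction. In the product rule the top coefficient c of
  \<open>p\<close> at \<open>d\<close> enters d times through \<open>pCons 0 (bdiff p)\<close> and
  once through \<open>p\<close>, while the degree bound makes the contribution of
  \<open>- bdiff p\<close> vanish.\<close>

lemma bdiff_degree_coeff:
  assumes "degree p \<le> Suc d"
  shows "degree (bdiff p) \<le> d \<and> coeff (bdiff p) d = of_nat (Suc d) * coeff p (Suc d)"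
  using assms
proof (induction p arbitrary: d)
  case 0
  show ?case by simp
next
  case (pCons a p)
  have dp: "degree p \<le> d"
    using pCons.prems by (cases "p = 0") auto
  show ?case
  proof (cases d)
    case 0
    then have "bdiff p = 0"
      using dp by (simp add: bdiff_eq_0)
    then show ?thesis
      using dp 0 by (simp add: bdiff_pCons)
  next
    case (Suc e)
    have IH: "degree (bdiff p) \<le> e" "coeff (bdiff p) e = of_nat (Suc e) * coeff p (Suc e)"
      using pCons.IH dp Suc by auto
    have "degree (pCons 0 (bdiff p) + p - bdiff p) \<le> d"
      using IH(1) dp Suc by (intro degree_diff_le degree_add_le)
        (auto intro: order_trans[OF degree_pCons_le])
    moreover have "coeff (bdiff p) d = 0"
      using IH(1) Suc by (simp add: coeff_eq_0)
    ultimately show ?thesis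
      using IH(2) Suc by (simp add: bdiff_pCons algebra_simps)
  qed
qed

lemma degree_bdiff_le: "degree p \<le> d \<Longrightarrow> degree (bdiff p) \<le> d - 1"
  by (cases d) (auto simp: bdiff_eq_0 dest: bdiff_degree_coeff)

text \<open>Differencing multiplies the leading coefficient by the degree, and a positive degree is
  a nonzero factor in characteristic zero.\<close>

lemma degree_0_if_bdiff_0:
  fixes p :: "'a::{idom, ring_char_0} poly"
  assumes "bdiff p = 0"
  shows "degree p = 0"
proof (cases "degree p")
  case (Suc d)
  then have "of_nat (Suc d) * lead_coeff p = 0"
    using bdiff_degree_coeff[of p d] assms by simp
  then have "p = 0"
    by (simp del: of_nat_Suc)
  then show ?thesis by simp
qed

lemma funpow_bdiff_top:
  "degree p \<le> d \<Longrightarrow> (bdiff ^^ d) p = [:fact d * coeff p d:]"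
proof (induction d arbitrary: p)
  case 0
  then show ?case by (auto elim: degree_eq_zeroE)
next
  case (Suc d)
  have "(bdiff ^^ Suc d) p = (bdiff ^^ d) (bdiff p)"
    by (simp add: funpow_swap1)
  also have "\<dots> = [:fact d * (of_nat (Suc d) * coeff p (Suc d)):]"
    using Suc.IH[of "bdiff p"] bdiff_degree_coeff[OF Suc.prems] by simp
  finally show ?case by (simp add: algebra_simps)
qed

section \<open>Partial differences\<close>

lemma coeff_Delta_x: "coeff (Delta_x p) k = bdiff (coeff p k)"
  by (simp add: Delta_x_def bdiff_def coeff_map_poly)

lemma Delta_y_eq_bdiff: "Delta_y = bdiff"
  by (simp add: fun_eq_iff Delta_y_def bdiff_def)

lemma Delta_x_pCons: "Delta_x (pCons a p) = pCons (bdiff a) (Delta_x p)"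
  by (rule poly_eqI) (simp add: coeff_Delta_x coeff_pCons split: nat.split)

lemma Delta_x_0 [simp]: "Delta_x 0 = 0"
  by (rule poly_eqI) (simp add: coeff_Delta_x)

lemma Delta_x_add: "Delta_x (p + q) = Delta_x p + Delta_x q"
  by (rule poly_eqI) (simp add: coeff_Delta_x bdiff_add)

lemma Delta_x_diff: "Delta_x (p - q) = Delta_x p - Delta_x q"
  by (rule poly_eqI) (simp add: coeff_Delta_x bdiff_diff)

lemma Delta_x_smult: "Delta_x (smult [:c:] p) = smult [:c:] (Delta_x p)"
  by (rule poly_eqI) (simp add: coeff_Delta_x bdiff_smult)

text \<open>\<open>Delta_x\<close> is additive and acts coefficientwise in \<open>y\<close>, so it
  passes through every term of the product rule for \<open>Delta_y\<close>.\<close>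

lemma Delta_x_Delta_y: "Delta_x (Delta_y p) = Delta_y (Delta_x p)"
  unfolding Delta_y_eq_bdiff
  by (induction p) (simp_all add: Delta_x_pCons bdiff_pCons Delta_x_add Delta_x_diff)

lemma funpow_Delta_x_Delta_y:
  "(Delta_y ^^ j) ((Delta_x ^^ i) p) = (Delta_x ^^ i) ((Delta_y ^^ j) p)"
proof -
  have *: "Delta_y ((Delta_x ^^ i) q) = (Delta_x ^^ i) (Delta_y q)" for q :: "'a bpoly"
    by (induction i) (simp_all flip: Delta_x_Delta_y)
  show ?thesis
    by (induction j) (simp_all add: *)
qed

section \<open>Effect of differences on bidegrees\<close>

lemma Delta_x_in_Pi2:
  assumes "p \<in> Pi2 m n"
  shows "Delta_x p \<in> Pi2 (m - 1) n"
proof -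
  have "degree (coeff (Delta_x p) k) \<le> m - 1" for k
    using assms unfolding coeff_Delta_x Pi2_def by (blast intro: degree_bdiff_le)
  moreover have "degree (Delta_x p) \<le> n"
    using assms by (intro degree_le) (simp add: coeff_Delta_x Pi2_def coeff_eq_0)
  ultimately show ?thesis
    by (simp add: Pi2_def)
qed

text \<open>The \<open>y\<close>-degree falls as in one variable. The \<open>x\<close>-degree does
  not grow because the product rule only shifts, adds and subtracts coefficients.\<close>

lemma Delta_y_in_Pi2:
  assumes "p \<in> Pi2 m n"
  shows "Delta_y p \<in> Pi2 m (n - 1)"
proof -
  have "degree (coeff (bdiff p) k) \<le> m" for k
    using assms unfolding Pi2_def mem_Collect_eq
  proof (elim conjE, induction p arbitrary: n k)
    case (pCons a p)
    have "degree (coeff p l) \<le> m" for l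
      using pCons.prems(1)[rule_format, of "Suc l"] by simp
    then have "degree (coeff (bdiff p) l) \<le> m" and "degree (coeff p l) \<le> m" for l
      using pCons.IH[of "degree p"] by auto
    then show ?case
      by (auto simp: bdiff_pCons coeff_pCons intro!: degree_diff_le degree_add_le split: nat.split)
  qed simp
  then show ?thesis
    using assms by (auto simp: Pi2_def Delta_y_eq_bdiff intro: degree_bdiff_le[simplified])
qed

lemma funpow_Delta_x_in_Pi2: "p \<in> Pi2 m n \<Longrightarrow> (Delta_x ^^ i) p \<in> Pi2 (m - i) n"
  by (induction i) (auto dest: Delta_x_in_Pi2 simp flip: diff_Suc_eq_diff_pred)

lemma funpow_Delta_y_in_Pi2: "p \<in> Pi2 m n \<Longrightarrow> (Delta_y ^^ j) p \<in> Pi2 m (n - j)"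
  by (induction j) (auto dest: Delta_y_in_Pi2 simp flip: diff_Suc_eq_diff_pred)

lemma funpow_Delta_in_Pi2:
  "p \<in> Pi2 m n \<Longrightarrow> (Delta_x ^^ i) ((Delta_y ^^ j) p) \<in> Pi2 (m - i) (n - j)"
  by (intro funpow_Delta_x_in_Pi2 funpow_Delta_y_in_Pi2)

lemma Delta_x_eq_0: "p \<in> Pi2 0 n \<Longrightarrow> Delta_x p = 0"
  by (rule poly_eqI) (simp add: coeff_Delta_x Pi2_def bdiff_eq_0)

lemma Delta_y_eq_0: "p \<in> Pi2 m 0 \<Longrightarrow> Delta_y p = 0"
  by (simp add: Delta_y_eq_bdiff Pi2_def bdiff_eq_0)

lemma funpow_Delta_x_0 [simp]: "(Delta_x ^^ i) 0 = 0"
  by (induction i) auto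

lemma funpow_Delta_y_0 [simp]: "(Delta_y ^^ j) 0 = 0"
  by (induction j) (auto simp: Delta_y_eq_bdiff)

text \<open>After \<open>m\<close> differences the \<open>x\<close>-degree bound is 0, so the next
  one annihilates the polynomial.\<close>

lemma funpow_Delta_x_eq_0:
  assumes "p \<in> Pi2 m n" "m < i"
  shows "(Delta_x ^^ i) p = 0"
proof -
  obtain k where k: "i = k + Suc m"
    using assms(2) by (metis add.commute less_imp_Suc_add add_Suc_right)
  have "(Delta_x ^^ Suc m) p = 0"
    using Delta_x_eq_0 funpow_Delta_x_in_Pi2[OF assms(1), of m] by simp
  then show ?thesis
    unfolding k funpow_add by (simp del: funpow.simps)
qed

lemma funpow_Delta_y_eq_0:
  assumes "p \<in> Pi2 m n" "n < j"
  shows "(Delta_y ^^ j) p = 0"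
proof -
  obtain k where k: "j = k + Suc n"
    using assms(2) by (metis add.commute less_imp_Suc_add add_Suc_right)
  have "(Delta_y ^^ Suc n) p = 0"
    using Delta_y_eq_0 funpow_Delta_y_in_Pi2[OF assms(1), of n] by simp
  then show ?thesis
    unfolding k funpow_add by (simp del: funpow.simps)
qed

lemma Pi2_mono: "p \<in> Pi2 i j \<Longrightarrow> i \<le> m \<Longrightarrow> j \<le> n \<Longrightarrow> p \<in> Pi2 m n"
  by (auto simp: Pi2_def intro: order_trans)

lemma Pi2_diff: "p \<in> Pi2 m n \<Longrightarrow> q \<in> Pi2 m n \<Longrightarrow> p - q \<in> Pi2 m n"
  by (simp add: Pi2_def degree_diff_le)

lemma Pi2_smult:
  assumes "p \<in> Pi2 m n"
  shows "smult [:c:] p \<in> Pi2 m n"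
  using assms by (auto simp: Pi2_def intro: order_trans[OF degree_smult_le])

lemma Pi2_sum: "(\<And>i. i \<in> A \<Longrightarrow> f i \<in> Pi2 m n) \<Longrightarrow> (\<Sum>i\<in>A. f i) \<in> Pi2 m n"
  by (induction A rule: infinite_finite_induct) (auto simp: Pi2_def degree_add_le)

lemma Pi2_0_0_const:
  assumes "p \<in> Pi2 0 0"
  obtains c where "p = [:[:c:]:]"
proof -
  obtain q where q: "p = [:q:]"
    using assms by (auto simp: Pi2_def elim: degree_eq_zeroE)
  then have "degree q = 0"
    using assms by (auto simp: Pi2_def dest: spec[of _ 0])
  then show ?thesis
    using q that by (auto elim: degree_eq_zeroE)
qed

section \<open>The interpolation functionals\<close>

definition node_val :: "'a::field_char_0 nodes \<Rightarrow> nat \<Rightarrow> nat \<Rightarrow> 'a bpoly \<Rightarrow> 'a" where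
  "node_val W i j p = eval2 (W (i, j)) ((Delta_x ^^ i) ((Delta_y ^^ j) p))"

lemma funpow_Delta_diff:
  "(Delta_x ^^ i) ((Delta_y ^^ j) (p - q)) =
     (Delta_x ^^ i) ((Delta_y ^^ j) p) - (Delta_x ^^ i) ((Delta_y ^^ j) q)"
proof -
  have "(Delta_y ^^ j) (p - q) = (Delta_y ^^ j) p - (Delta_y ^^ j) q"
    by (induction j) (auto simp: Delta_y_eq_bdiff bdiff_diff)
  moreover have "(Delta_x ^^ i) (u - v) = (Delta_x ^^ i) u - (Delta_x ^^ i) v" for u v :: "'a bpoly"
    by (induction i) (auto simp: Delta_x_diff)
  ultimately show ?thesis by simp
qed

lemma funpow_Delta_smult:
  "(Delta_x ^^ i) ((Delta_y ^^ j) (smult [:c:] p)) = smult [:c:] ((Delta_x ^^ i) ((Delta_y ^^ j) p))"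
proof -
  have "(Delta_y ^^ j) (smult [:c:] p) = smult [:c:] ((Delta_y ^^ j) p)"
    by (induction j) (auto simp: Delta_y_eq_bdiff bdiff_smult)
  moreover have "(Delta_x ^^ i) (smult [:c:] u) = smult [:c:] ((Delta_x ^^ i) u)" for u :: "'a bpoly"
    by (induction i) (auto simp: Delta_x_smult)
  ultimately show ?thesis by simp
qed

lemma eval2_diff: "eval2 z (p - q) = eval2 z p - eval2 z q"
  by (simp add: eval2_def)

lemma eval2_smult: "eval2 z (smult [:c:] p) = c * eval2 z p"
  by (simp add: eval2_def)

lemma node_val_0: "node_val W i j 0 = 0"
  by (simp add: node_val_def eval2_def)

lemma node_val_diff: "node_val W i j (p - q) = node_val W i j p - node_val W i j q"
  by (simp add: node_val_def funpow_Delta_diff eval2_diff)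

lemma node_val_smult: "node_val W i j (smult [:c:] p) = c * node_val W i j p"
  by (simp add: node_val_def funpow_Delta_smult eval2_smult)

lemma node_val_add: "node_val W i j (p + q) = node_val W i j p + node_val W i j q"
  using node_val_diff[of W i j "p + q" q] by simp

lemma node_val_sum: "node_val W i j (\<Sum>k\<in>A. f k) = (\<Sum>k\<in>A. node_val W i j (f k))"
  by (induction A rule: infinite_finite_induct) (auto simp: node_val_0 node_val_add)

text \<open>Since the differences commute, those already applied to \<open>p\<close> can be traded
  for a shift of the node indices. This reduces a problem to one of smaller bidegree.\<close>

lemma node_val_shift_nodes:
  "node_val (shift_nodes a b W) i j ((Delta_x ^^ a) ((Delta_y ^^ b) p)) = node_val W (i + a) (j + b) p"
  by (simp add: node_val_def shift_nodes_def funpow_add funpow_Delta_x_Delta_y)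

lemma node_val_outside:
  assumes "p \<in> Pi2 m n" "m < i \<or> n < j"
  shows "node_val W i j p = 0"
proof (cases "n < j")
  case True
  then show ?thesis
    using funpow_Delta_y_eq_0[OF assms(1)] by (simp add: node_val_def eval2_def)
next
  case False
  then show ?thesis
    using assms(2) funpow_Delta_x_eq_0[OF funpow_Delta_y_in_Pi2[OF assms(1)]]
    by (simp add: node_val_def eval2_def)
qed

section \<open>Unique solvability of the interpolation problem\<close>

theorem interpolation_unique:
  assumes "p \<in> Pi2 m n" "\<And>i j. i \<le> m \<Longrightarrow> j \<le> n \<Longrightarrow> node_val W i j p = 0"
  shows "p = 0"
  using assms
proof (induction "m + n" arbitrary: m n p W rule: less_induct)
  case less
  \<comment> \<open>Either \<open>Delta_x p\<close> vanishes for degree reasons, or it solves the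
    homogeneous problem of smaller bidegree for shifted nodes; this is why \<open>W\<close> is
    arbitrary in the induction. \<open>Delta_y p\<close> is treated alike.\<close>
  have "Delta_x p = 0"
  proof (cases m)
    case 0
    then show ?thesis using less.prems(1) Delta_x_eq_0 by blast
  next
    case (Suc k)
    have "node_val (shift_nodes 1 0 W) i j (Delta_x p) = 0" if "i \<le> k" "j \<le> n" for i j
      using node_val_shift_nodes[of 1 0 W i j p] less.prems(2)[of "i + 1" j] that Suc by simp
    moreover have "Delta_x p \<in> Pi2 k n"
      using Delta_x_in_Pi2[OF less.prems(1)] Suc by simp
    ultimately show ?thesis
      using less.hyps[of k n "Delta_x p" "shift_nodes 1 0 W"] Suc by simp
  qed
  moreover have "Delta_y p = 0"
  proof (cases n)
    case 0
    then show ?thesis using less.prems(1) Delta_y_eq_0 by blast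
  next
    case (Suc k)
    have "node_val (shift_nodes 0 1 W) i j (Delta_y p) = 0" if "i \<le> m" "j \<le> k" for i j
      using node_val_shift_nodes[of 0 1 W i j p] less.prems(2)[of i "j + 1"] that Suc by simp
    moreover have "Delta_y p \<in> Pi2 m k"
      using Delta_y_in_Pi2[OF less.prems(1)] Suc by simp
    ultimately show ?thesis
      using less.hyps[of m k "Delta_y p" "shift_nodes 0 1 W"] Suc by simp
  qed
  \<comment> \<open>In characteristic zero only constants are killed by both differences; the
    condition at index (0, 0) then forces the constant to be 0.\<close>
  ultimately have "bdiff (coeff p k) = 0" "bdiff p = 0" for k
    by (auto simp: Delta_y_eq_bdiff simp flip: coeff_Delta_x)
  then have "p \<in> Pi2 0 0"
    by (simp add: Pi2_def degree_0_if_bdiff_0)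
  then obtain c where "p = [:[:c:]:]"
    by (rule Pi2_0_0_const)
  then show ?case
    using less.prems(2)[of 0 0] by (simp add: node_val_def eval2_def)
qed

lemma funpow_Delta_monom:
  "(Delta_x ^^ m) ((Delta_y ^^ n) (monom (monom 1 m) n)) =
    ([:[:fact m * fact n:]:] :: 'a::field_char_0 bpoly)"
proof -
  have x: "(Delta_x ^^ m) [:q:] = [:(bdiff ^^ m) q:]" for q :: "'a poly"
    by (induction m) (simp_all add: Delta_x_pCons)
  \<comment> \<open>The factorial on the left lives in the polynomials in \<open>x\<close>, since
    the \<open>y\<close>-differences are taken over that ring; it has to become a scalar of the
    field.\<close>
  have f: "fact n * monom 1 m = smult (fact n) (monom (1::'a) m)"
    using of_nat_poly[of "fact n", where 'a = 'a] by simp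
  have "(Delta_y ^^ n) (monom (monom 1 m) n) = [:smult (fact n) (monom (1::'a) m):]"
    using funpow_bdiff_top[of "monom (monom (1::'a) m) n" n]
    by (simp add: Delta_y_eq_bdiff degree_monom_le f)
  moreover have "degree (smult (fact n) (monom (1::'a) m)) \<le> m"
    using degree_smult_le degree_monom_le by (rule order_trans)
  ultimately show ?thesis
    using funpow_bdiff_top[of "smult (fact n) (monom (1::'a) m)" m] by (simp add: x)
qed

lemma monom_in_Pi2: "monom (monom 1 m) n \<in> Pi2 m n"
  by (auto simp: Pi2_def degree_monom_le)

text \<open>The monomial of bidegree (\<open>m\<close>, \<open>n\<close>) has the right value at the
  top index, and solutions of smaller type remove its other values. Prescribing values at all
  indices makes each such solution invisible to every functional but its own.\<close>

theorem interpolation_exists: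
  "\<exists>g\<in>Pi2 m n. \<forall>i j. node_val W i j g = (if i = m \<and> j = n then fact m * fact n else 0)"
proof (induction "m + n" arbitrary: m n rule: less_induct)
  case less
  define A where "A = {..m} \<times> {..n} - {(m, n)}"
  have "finite A"
    by (simp add: A_def)
  have "\<exists>g. g \<in> Pi2 (fst k) (snd k) \<and>
      (\<forall>i j. node_val W i j g = (if i = fst k \<and> j = snd k then fact i * fact j else 0))"
    if "k \<in> A" for k
  proof -
    have "fst k + snd k < m + n"
      using that by (cases k) (auto simp: A_def)
    from less[OF this] show ?thesis
      by (metis (no_types, lifting))
  qed
  then obtain G where G: "\<And>k. k \<in> A \<Longrightarrow> G k \<in> Pi2 (fst k) (snd k)"
      "\<And>k i j. k \<in> A \<Longrightarrow> node_val W i j (G k) = (if k = (i, j) then fact i * fact j else 0)"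
    by (metis prod.collapse fst_conv snd_conv)
  define b :: "'a bpoly" where "b = monom (monom 1 m) n"
  define v where "v i j = node_val W i j b" for i j
  have b: "b \<in> Pi2 m n"
    by (simp add: b_def monom_in_Pi2)
  have vtop: "v m n = fact m * fact n"
    by (simp add: v_def b_def node_val_def funpow_Delta_monom eval2_def)
  \<comment> \<open>Each \<open>G k\<close> has the product of two factorials as its only nonzero
    value, so these quotients cancel all lower values of \<open>b\<close> at once.\<close>
  define g where
    "g = b - (\<Sum>k\<in>A. smult [:v (fst k) (snd k) / (fact (fst k) * fact (snd k)):] (G k))"
  have "G k \<in> Pi2 m n" if "k \<in> A" for k
    using Pi2_mono[OF G(1)[OF that]] that by (auto simp: A_def)
  then have "g \<in> Pi2 m n"
    unfolding g_def using b by (intro Pi2_diff Pi2_sum Pi2_smult)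
  moreover have "node_val W i j g = (if i = m \<and> j = n then fact m * fact n else 0)" for i j
  proof -
    have "node_val W i j g =
        v i j - (\<Sum>k\<in>A. v (fst k) (snd k) / (fact (fst k) * fact (snd k)) * node_val W i j (G k))"
      by (simp add: g_def node_val_diff node_val_sum node_val_smult v_def)
    also have "(\<Sum>k\<in>A. v (fst k) (snd k) / (fact (fst k) * fact (snd k)) * node_val W i j (G k)) =
        (\<Sum>k\<in>A. if k = (i, j) then v i j else 0)"
      by (rule sum.cong) (auto simp: G(2))
    also have "\<dots> = (if (i, j) \<in> A then v i j else 0)"
      using \<open>finite A\<close> by simp
    finally have *: "node_val W i j g = v i j - (if (i, j) \<in> A then v i j else 0)" .
    show ?thesis
    proof (cases "i \<le> m \<and> j \<le> n")
      case True
      then show ?thesis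
        using * vtop by (auto simp: A_def)
    next
      case False
      then show ?thesis
        using node_val_outside[OF \<open>g \<in> Pi2 m n\<close>] by auto
    qed
  qed
  ultimately show ?case by blast
qed

section \<open>The polynomials \<open>gtilde\<close> and the change of one node\<close>

lemma gtilde_eqI:
  assumes "g \<in> Pi2 m n"
    and "\<And>i j. i \<le> m \<Longrightarrow> j \<le> n \<Longrightarrow>
      node_val W i j g = (if i = m \<and> j = n then fact m * fact n else 0)"
  shows "gtilde m n W = g"
  unfolding gtilde_def node_val_def[symmetric]
proof (rule the_equality)
  show "g \<in> Pi2 m n \<and> (\<forall>i\<le>m. \<forall>j\<le>n. node_val W i j g =
      fact m * fact n * (if i = m then 1 else 0) * (if j = n then 1 else 0))"
    using assms by auto
next
  fix h
  assume h: "h \<in> Pi2 m n \<and> (\<forall>i\<le>m. \<forall>j\<le>n. node_val W i j h =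
      fact m * fact n * (if i = m then 1 else 0) * (if j = n then 1 else 0))"
  have "h - g = 0"
  proof (rule interpolation_unique)
    show "h - g \<in> Pi2 m n"
      using h assms(1) by (simp add: Pi2_diff)
    show "node_val W i j (h - g) = 0" if "i \<le> m" "j \<le> n" for i j
      using h assms(2) that by (auto simp: node_val_diff)
  qed
  then show "h = g" by simp
qed

text \<open>The values need no bounds on \<open>i\<close> and \<open>j\<close>, because the
  existence theorem also gives the zeros beyond (\<open>m\<close>, \<open>n\<close>).\<close>

lemma gtilde_in_Pi2: "gtilde m n W \<in> Pi2 m n"
  and node_val_gtilde:
    "node_val W i j (gtilde m n W) = (if i = m \<and> j = n then fact m * fact n else 0)"
proof -
  obtain g where g: "g \<in> Pi2 m n"
      "\<And>i j. node_val W i j g = (if i = m \<and> j = n then fact m * fact n else 0)"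
    using interpolation_exists by metis
  then have "gtilde m n W = g"
    by (intro gtilde_eqI)
  then show "gtilde m n W \<in> Pi2 m n"
    and "node_val W i j (gtilde m n W) = (if i = m \<and> j = n then fact m * fact n else 0)"
    using g by simp_all
qed

text \<open>Both sides have values only at the top index of the shifted problem; the scalar is the
  quotient of \<open>fact m * fact n\<close> by \<open>fact (m - a) * fact (n - b)\<close>.\<close>

lemma funpow_Delta_gtilde:
  assumes "a \<le> m" "b \<le> n"
  shows "(Delta_x ^^ a) ((Delta_y ^^ b) (gtilde m n W)) =
    smult [:of_nat (m choose a) * of_nat (n choose b) * fact a * fact b:]
      (gtilde (m - a) (n - b) (shift_nodes a b W))"
proof -
  let ?c = "of_nat (m choose a) * of_nat (n choose b) * fact a * fact b :: 'a"
  let ?p = "(Delta_x ^^ a) ((Delta_y ^^ b) (gtilde m n W))"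
  have c: "?c * (fact (m - a) * fact (n - b)) = fact m * fact n"
    using assms by (simp add: binomial_fact)
  have "?p - smult [:?c:] (gtilde (m - a) (n - b) (shift_nodes a b W)) = 0"
  proof (rule interpolation_unique)
    show "?p - smult [:?c:] (gtilde (m - a) (n - b) (shift_nodes a b W)) \<in> Pi2 (m - a) (n - b)"
      by (intro Pi2_diff Pi2_smult funpow_Delta_in_Pi2 gtilde_in_Pi2)
    show "node_val (shift_nodes a b W) i j
        (?p - smult [:?c:] (gtilde (m - a) (n - b) (shift_nodes a b W))) = 0" for i j
      using assms c
      by (auto simp: node_val_diff node_val_smult node_val_shift_nodes node_val_gtilde)
  qed
  then show ?thesis by simp
qed

lemma gtilde_0_0: "gtilde 0 0 W = 1"
  by (rule gtilde_eqI) (auto simp: Pi2_def node_val_def eval2_def)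

theorem theorem8:
  fixes Z :: "nat \<times> nat \<Rightarrow> 'a::field_char_0 \<times> 'a"
    and zs :: "'a \<times> 'a"
    and m n i0 j0 :: nat
  assumes "i0 \<le> m" and "j0 \<le> n" and "(i0, j0) \<noteq> (m, n)"
  shows "gtilde m n (Z((i0, j0) := zs)) =
    gtilde m n Z -
    smult [: of_nat (m choose i0) * of_nat (n choose j0) *
             eval2 zs (gtilde (m - i0) (n - j0) (shift_nodes i0 j0 Z)) :]
      (gtilde i0 j0 Z)"
    (is "_ = _ - smult [:?c:] _")
proof (rule gtilde_eqI)
  show "gtilde m n Z - smult [:?c:] (gtilde i0 j0 Z) \<in> Pi2 m n"
    using assms by (intro Pi2_diff Pi2_smult gtilde_in_Pi2 Pi2_mono[OF gtilde_in_Pi2[of i0 j0]])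
next
  fix i j
  show "node_val (Z((i0, j0) := zs)) i j (gtilde m n Z - smult [:?c:] (gtilde i0 j0 Z)) =
    (if i = m \<and> j = n then fact m * fact n else 0)"
  proof (cases "(i, j) = (i0, j0)")
    case True
    \<comment> \<open>At the moved node the first term gives \<open>?c * fact i0 * fact j0\<close>.
      The differenced \<open>gtilde i0 j0 Z\<close> is the constant
      \<open>fact i0 * fact j0\<close>, wherever it is evaluated, so the two terms cancel. The
      required value is 0 because this is not the top index.\<close>
    then show ?thesis
      using assms funpow_Delta_gtilde[of i0 i0 j0 j0 Z]
      by (auto simp: node_val_diff node_val_smult)
        (simp_all add: node_val_def funpow_Delta_gtilde eval2_smult gtilde_0_0, simp_all add: eval2_def)
  next
    case False
    then have "node_val (Z((i0, j0) := zs)) i j p = node_val Z i j p" for p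
      by (auto simp: node_val_def)
    \<comment> \<open>The node is unchanged here, and \<open>gtilde i0 j0 Z\<close> has value 0 at
      every index other than (\<open>i0\<close>, \<open>j0\<close>).\<close>
    then show ?thesis
      using False by (auto simp: node_val_diff node_val_smult node_val_gtilde)
  qed
qed

end
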